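(* Let $0<p<\infty$ and let $\{X_n\}_{n=0}^{\infty}$ be a real Gaussian process (not necessarily independent, not necessarily centered). Then $\{X_n\}_{n=0}^{\infty}$ has the $L_p$-property if and only if $\{X_n-\mathbb{E}X_n\}_{n=0}^{\infty}$ has the $L_p$-property and $\{\mathbb{E}X_n\}_{n=0}^{\infty}$ is a coefficient multiplier from $H^2$ to $H^p$.
   Context: $\mathbb{D}$ is the open unit disk in $\mathbb{C}$, and $H^p=H^p(\mathbb{D})$, $0<p<\infty$, is the Hardy space of analytic functions on $\mathbb{D}$; $H^2$ consists of the series $\sum_{n\ge0} a_nz^n$ with complex coefficients $\{a_n\}\in\ell^2$. A real Gaussian process $\{X_n\}_{n=0}^\infty$ is a sequence of real random variables on a common probability space which is jointly Gaussian (every finite linear combination is a Gaussian variable, possibly degenerate). A sequence of random variables $\{X_n\}_{n=0}^\infty$ has the $L_p$-property if for any $f(z)=\sum_{n=0}^\infty a_nz^n\in H^2$ one has $\sum_{n=0}^\infty a_nX_nz^n\in H^p$ almost surely. A sequence $\{\lambda_n\}_{n=0}^\infty$ of scalars is a coefficient multiplier from $H^2$ to $H^p$ if $\sum_{n=0}^\infty a_n\lambda_nz^n\in H^p$ for every $f(z)=\sum_{n=0}^\infty a_nz^n\in H^2$. *)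

theory Defs
  imports "HOL-Probability.Probability" "HOL-Complex_Analysis.Complex_Analysis"
begin

definition hardy_space :: "real \<Rightarrow> (complex \<Rightarrow> complex) set" where
  "hardy_space p = {f. f holomorphic_on ball 0 1 \<and>
     (SUP r\<in>{0<..<1}. \<integral>\<^sup>+\<theta>\<in>{0..2*pi}.
        ennreal (cmod (f (complex_of_real r * cis \<theta>)) powr p / (2*pi)) \<partial>lborel) < \<infinity>}"

text \<open>Membership of a formal series \<open>\<Sum>\<^sub>n a\<^sub>n z\<^sup>n\<close> in \<open>H\<^sup>p\<close>. Convergence on the whole disk is
  part of the condition: \<^const>\<open>suminf\<close> would give a divergent series a junk value.\<close>

definition series_in_hardy :: "real \<Rightarrow> (nat \<Rightarrow> complex) \<Rightarrow> bool" where
  "series_in_hardy p a \<longleftrightarrow>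
     (\<exists>f\<in>hardy_space p. \<forall>z\<in>ball 0 1. (\<lambda>n. a n * z ^ n) sums f z)"

text \<open>Sanity check: for \<open>p = 2\<close> the definition yields exactly the series with
  square-summable coefficients.\<close>

lemma has_integral_cis_multiple:
  fixes k :: int
  shows "((\<lambda>\<theta>. cis (of_int k * \<theta>)) has_integral (if k = 0 then of_real (2*pi) else 0)) {0..2*pi}"
proof (cases "k = 0")
  case True
  have "((\<lambda>_. 1::complex) has_integral (of_real (2*pi))) {0..2*pi}"
    using has_integral_const_real[of "1::complex" 0 "2*pi"] by (simp add: scaleR_conv_of_real)
  with True show ?thesis by (simp add: cis_zero)
next
  case False
  have "((\<lambda>\<theta>. cis (of_int k * \<theta>)) has_integral
      (cis (of_int k * (2*pi)) / (\<i> * of_int k) - cis (of_int k * 0) / (\<i> * of_int k))) {0..2*pi}"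
  proof (rule fundamental_theorem_of_calculus)
    fix x :: real
    have "((\<lambda>z. exp (\<i> * (of_int k * z)) / (\<i> * of_int k)) has_field_derivative
        exp (\<i> * (of_int k * of_real x))) (at (of_real x))"
      using False by (auto intro!: derivative_eq_intros simp: divide_simps complex_eq_iff[of "- _"])
    from has_vector_derivative_real_field[OF this]
    show "((\<lambda>\<theta>. cis (of_int k * \<theta>) / (\<i> * of_int k)) has_vector_derivative cis (of_int k * x))
        (at x within {0..2*pi})"
      by (simp add: cis_conv_exp)
  qed simp
  moreover have "cis (of_int k * (2*pi)) = 1"
    using cis_multiple_2pi[of "of_int k"] by (simp add: mult.commute)
  ultimately show ?thesis using False by simp
qed

lemma has_integral_norm_sq_trig_poly:
  fixes b :: "nat \<Rightarrow> complex"
  shows "((\<lambda>\<theta>. (cmod (\<Sum>n<N. b n * cis (real n * \<theta>)))\<^sup>2) has_integral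
      (2*pi * (\<Sum>n<N. (cmod (b n))\<^sup>2))) {0..2*pi}"
proof -
  let ?S = "\<lambda>\<theta>. \<Sum>n<N. b n * cis (real n * \<theta>)"
  have eq: "complex_of_real ((cmod (?S \<theta>))\<^sup>2) =
      (\<Sum>m<N. \<Sum>n<N. b m * cnj (b n) * cis (of_int (int m - int n) * \<theta>))" for \<theta>
  proof -
    have "complex_of_real ((cmod (?S \<theta>))\<^sup>2) = ?S \<theta> * cnj (?S \<theta>)"
      by (simp only: complex_norm_square)
    also have "\<dots> = (\<Sum>m<N. \<Sum>n<N. (b m * cis (real m * \<theta>)) * cnj (b n * cis (real n * \<theta>)))"
      by (simp only: cnj_sum sum_product)
    also have "\<dots> = (\<Sum>m<N. \<Sum>n<N. b m * cnj (b n) * (cis (real m * \<theta>) * cis (- (real n * \<theta>))))"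
      by (intro sum.cong refl) (simp add: cis_cnj mult_ac)
    also have "\<dots> = (\<Sum>m<N. \<Sum>n<N. b m * cnj (b n) * cis (of_int (int m - int n) * \<theta>))"
      by (intro sum.cong refl) (simp add: cis_mult algebra_simps)
    finally show ?thesis .
  qed
  have "((\<lambda>\<theta>. \<Sum>m<N. \<Sum>n<N. b m * cnj (b n) * cis (of_int (int m - int n) * \<theta>)) has_integral
      (\<Sum>m<N. \<Sum>n<N. b m * cnj (b n) * (if int m - int n = 0 then of_real (2*pi) else 0))) {0..2*pi}"
    by (intro has_integral_sum has_integral_mult_right has_integral_cis_multiple) auto
  also have "(\<Sum>m<N. \<Sum>n<N. b m * cnj (b n) * (if int m - int n = 0 then of_real (2*pi) else 0)) =
      (\<Sum>m<N. \<Sum>n<N. if m = n then b m * cnj (b n) * of_real (2*pi) else 0)"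
    by (intro sum.cong refl) auto
  also have "\<dots> = (\<Sum>m<N. b m * cnj (b m) * of_real (2*pi))"
    by (intro sum.cong refl) (simp add: sum.delta')
  also have "\<dots> = complex_of_real (2*pi * (\<Sum>n<N. (cmod (b n))\<^sup>2))"
    by (simp add: sum_distrib_left complex_norm_square mult_ac del: of_real_power)
  finally have "((\<lambda>\<theta>. complex_of_real ((cmod (?S \<theta>))\<^sup>2)) has_integral
      complex_of_real (2*pi * (\<Sum>n<N. (cmod (b n))\<^sup>2))) {0..2*pi}"
    by (simp only: eq)
  from has_integral_Re[OF this] show ?thesis by (simp only: Re_complex_of_real)
qed

lemma circle_mean_sq_eq:
  fixes a :: "nat \<Rightarrow> complex"
  assumes sums: "\<And>z. z \<in> ball 0 1 \<Longrightarrow> (\<lambda>n. a n * z ^ n) sums f z" and r: "0 < r" "r < 1"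
  shows "summable (\<lambda>n. (cmod (a n) * r ^ n)\<^sup>2)"
    and "(\<integral>\<^sup>+\<theta>\<in>{0..2*pi}. ennreal (cmod (f (complex_of_real r * cis \<theta>)) powr 2 / (2*pi)) \<partial>lborel) =
      ennreal (\<Sum>n. (cmod (a n) * r ^ n)\<^sup>2)"
proof -
  define b where "b n = a n * complex_of_real r ^ n" for n
  define s where "s = (1 + r) / 2"
  have "0 < s" "s < 1" "r < s"
    using r by (auto simp: s_def)
  then have "summable (\<lambda>n. a n * complex_of_real s ^ n)"
    using sums[of "complex_of_real s"] by (auto simp: sums_iff)
  moreover have "norm (complex_of_real r) < norm (complex_of_real s)"
    using r \<open>r < s\<close> by simp
  ultimately have abs: "summable (\<lambda>n. cmod (b n))"
    using powser_insidea unfolding b_def by blast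
  have nb: "cmod (b n) = cmod (a n) * r ^ n" for n
    using r by (simp add: b_def norm_mult norm_power)
  have "summable (\<lambda>n. (cmod (b n))\<^sup>2)"
  proof (rule summable_comparison_test_ev[OF _ abs])
    have "(\<lambda>n. cmod (b n)) \<longlonglongrightarrow> 0"
      by (rule summable_LIMSEQ_zero[OF abs])
    then have "\<forall>\<^sub>F n in sequentially. cmod (b n) < 1"
      by (rule order_tendstoD) simp
    then show "\<forall>\<^sub>F n in sequentially. norm ((cmod (b n))\<^sup>2) \<le> cmod (b n)"
    proof eventually_elim
      case (elim n)
      then show ?case
        using mult_left_le[of "cmod (b n)" "cmod (b n)"] by (simp add: power2_eq_square)
    qed
  qed
  then show sq: "summable (\<lambda>n. (cmod (a n) * r ^ n)\<^sup>2)"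
    by (simp only: nb)
  let ?S = "\<lambda>N \<theta>. \<Sum>n<N. b n * cis (real n * \<theta>)"
  have b_cis: "b n * cis (real n * \<theta>) = a n * (complex_of_real r * cis \<theta>) ^ n" for n \<theta>
    by (simp add: b_def power_mult_distrib Complex.DeMoivre)
  have "((\<lambda>\<theta>. (cmod (f (complex_of_real r * cis \<theta>)))\<^sup>2) has_integral
      (2*pi * (\<Sum>n. (cmod (b n))\<^sup>2))) {0..2*pi}"
  proof (rule has_integral_dominated_convergence)
    show "((\<lambda>\<theta>. (cmod (?S N \<theta>))\<^sup>2) has_integral (2*pi * (\<Sum>n<N. (cmod (b n))\<^sup>2))) {0..2*pi}" for N
      by (rule has_integral_norm_sq_trig_poly)
    show "(\<lambda>_::real. (\<Sum>n. cmod (b n))\<^sup>2) integrable_on {0..2*pi}"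
      by (rule integrable_const_ivl)
    show "\<forall>x\<in>{0..2*pi}. norm ((cmod (?S N x))\<^sup>2) \<le> (\<Sum>n. cmod (b n))\<^sup>2" for N
    proof
      fix x :: real
      have "cmod (?S N x) \<le> (\<Sum>n<N. cmod (b n * cis (real n * x)))"
        by (rule norm_sum)
      also have "\<dots> = (\<Sum>n<N. cmod (b n))"
        by (simp add: norm_mult)
      also have "\<dots> \<le> (\<Sum>n. cmod (b n))"
        by (rule sum_le_suminf[OF abs]) auto
      finally show "norm ((cmod (?S N x))\<^sup>2) \<le> (\<Sum>n. cmod (b n))\<^sup>2"
        by (simp add: power_mono)
    qed
    show "\<forall>x\<in>{0..2*pi}. (\<lambda>N. (cmod (?S N x))\<^sup>2) \<longlonglongrightarrow> (cmod (f (complex_of_real r * cis x)))\<^sup>2"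
    proof
      fix x :: real
      have "complex_of_real r * cis x \<in> ball 0 1"
        using r by (simp add: norm_mult)
      from sums[OF this] have "(\<lambda>N. ?S N x) \<longlonglongrightarrow> f (complex_of_real r * cis x)"
        by (simp add: sums_def b_cis)
      then show "(\<lambda>N. (cmod (?S N x))\<^sup>2) \<longlonglongrightarrow> (cmod (f (complex_of_real r * cis x)))\<^sup>2"
        by (intro tendsto_intros)
    qed
    show "(\<lambda>N. 2*pi * (\<Sum>n<N. (cmod (b n))\<^sup>2)) \<longlonglongrightarrow> 2*pi * (\<Sum>n. (cmod (b n))\<^sup>2)"
      using sq by (intro tendsto_intros summable_LIMSEQ) (simp only: nb)
  qed
  from has_integral_divide[OF this, of "2*pi"]
  have "((\<lambda>\<theta>. cmod (f (complex_of_real r * cis \<theta>)) powr 2 / (2*pi)) has_integral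
      (\<Sum>n. (cmod (b n))\<^sup>2)) {0..2*pi}"
    by (simp add: powr_numeral)
  from nn_integral_has_integral_lebesgue'[OF _ this]
  show "(\<integral>\<^sup>+\<theta>\<in>{0..2*pi}. ennreal (cmod (f (complex_of_real r * cis \<theta>)) powr 2 / (2*pi)) \<partial>lborel) =
      ennreal (\<Sum>n. (cmod (a n) * r ^ n)\<^sup>2)"
    by (simp add: nb)
qed

lemma series_in_hardy_2_iff:
  "series_in_hardy 2 a \<longleftrightarrow> summable (\<lambda>n. (cmod (a n))\<^sup>2)"
proof
  assume "series_in_hardy 2 a"
  then obtain f where f: "f \<in> hardy_space 2"
    and sums: "\<And>z. z \<in> ball 0 1 \<Longrightarrow> (\<lambda>n. a n * z ^ n) sums f z"
    unfolding series_in_hardy_def by blast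
  define C where "C = (SUP r\<in>{0<..<1}. \<integral>\<^sup>+\<theta>\<in>{0..2*pi}.
        ennreal (cmod (f (complex_of_real r * cis \<theta>)) powr 2 / (2*pi)) \<partial>lborel)"
  have "C < \<infinity>" using f by (simp add: hardy_space_def C_def)
  have le: "(\<Sum>n<N. (cmod (a n) * r ^ n)\<^sup>2) \<le> enn2real C" if r: "0 < r" "r < 1" for r N
  proof -
    have "ennreal (\<Sum>n. (cmod (a n) * r ^ n)\<^sup>2) \<le> C"
      unfolding C_def
    proof (rule SUP_upper2)
      show "r \<in> {0<..<1}" using r by simp
    qed (rule eq_refl[OF circle_mean_sq_eq(2)[OF sums r, symmetric]])
    also have "C = ennreal (enn2real C)"
      using \<open>C < \<infinity>\<close> by simp
    finally have "(\<Sum>n. (cmod (a n) * r ^ n)\<^sup>2) \<le> enn2real C"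
      by (simp add: ennreal_le_iff)
    moreover have "(\<Sum>n<N. (cmod (a n) * r ^ n)\<^sup>2) \<le> (\<Sum>n. (cmod (a n) * r ^ n)\<^sup>2)"
      by (rule sum_le_suminf[OF circle_mean_sq_eq(1)[OF sums r]]) auto
    ultimately show ?thesis by simp
  qed
  have "(\<Sum>n<N. (cmod (a n))\<^sup>2) \<le> enn2real C" for N
  proof (rule tendsto_upperbound)
    show "((\<lambda>r. \<Sum>n<N. (cmod (a n) * r ^ n)\<^sup>2) \<longlongrightarrow> (\<Sum>n<N. (cmod (a n))\<^sup>2)) (at_left (1::real))"
      by (auto intro!: tendsto_eq_intros)
    show "\<forall>\<^sub>F r in at_left (1::real). (\<Sum>n<N. (cmod (a n) * r ^ n)\<^sup>2) \<le> enn2real C"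
      using eventually_at_left_real[of 0 "1::real"] le by (auto elim!: eventually_mono)
  qed simp
  then show "summable (\<lambda>n. (cmod (a n))\<^sup>2)"
    by (intro summableI_nonneg_bounded) auto
next
  assume sq: "summable (\<lambda>n. (cmod (a n))\<^sup>2)"
  have "(\<lambda>n. (cmod (a n))\<^sup>2) \<longlonglongrightarrow> 0"
    by (rule summable_LIMSEQ_zero[OF sq])
  then have "\<forall>\<^sub>F n in sequentially. (cmod (a n))\<^sup>2 < 1"
    by (rule order_tendstoD) simp
  then have bounded: "\<forall>\<^sub>F n in sequentially. cmod (a n) \<le> 1"
    by (auto elim!: eventually_mono simp: power_less_one_iff abs_square_less_1)
  have sums: "(\<lambda>n. a n * z ^ n) sums (\<Sum>n. a n * z ^ n)" if "z \<in> ball 0 1" for z :: complex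
  proof (rule summable_sums, rule summable_comparison_test_ev)
    show "\<forall>\<^sub>F n in sequentially. norm (a n * z ^ n) \<le> cmod z ^ n"
      using bounded
      by eventually_elim (simp add: norm_mult norm_power mult_left_le_one_le)
    show "summable (\<lambda>n. cmod z ^ n)"
      using that by (intro summable_geometric) simp
  qed
  define f where "f z = (\<Sum>n. a n * z ^ n)" for z
  have "f holomorphic_on ball 0 1"
    using power_series_holomorphic[of 0 1 a f] sums by (simp add: f_def)
  moreover have "(SUP r\<in>{0<..<1}. \<integral>\<^sup>+\<theta>\<in>{0..2*pi}.
        ennreal (cmod (f (complex_of_real r * cis \<theta>)) powr 2 / (2*pi)) \<partial>lborel)
      \<le> ennreal (\<Sum>n. (cmod (a n))\<^sup>2)"
  proof (rule SUP_least)
    fix r :: real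
    assume "r \<in> {0<..<1}"
    then have r: "0 < r" "r < 1" by auto
    have s: "\<And>z. z \<in> ball 0 1 \<Longrightarrow> (\<lambda>n. a n * z ^ n) sums f z"
      using sums by (simp add: f_def)
    have "(\<Sum>n. (cmod (a n) * r ^ n)\<^sup>2) \<le> (\<Sum>n. (cmod (a n))\<^sup>2)"
    proof (rule suminf_le[OF _ circle_mean_sq_eq(1)[OF s r] sq])
      show "(cmod (a n) * r ^ n)\<^sup>2 \<le> (cmod (a n))\<^sup>2" for n
        using r by (intro power_mono mult_left_le power_le_one) auto
    qed
    then show "(\<integral>\<^sup>+\<theta>\<in>{0..2*pi}. ennreal (cmod (f (complex_of_real r * cis \<theta>)) powr 2 / (2*pi)) \<partial>lborel)
        \<le> ennreal (\<Sum>n. (cmod (a n))\<^sup>2)"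
      by (intro ord_eq_le_trans[OF circle_mean_sq_eq(2)[OF s r]] ennreal_leI)
  qed
  then have "(SUP r\<in>{0<..<1}. \<integral>\<^sup>+\<theta>\<in>{0..2*pi}.
        ennreal (cmod (f (complex_of_real r * cis \<theta>)) powr 2 / (2*pi)) \<partial>lborel) < \<infinity>"
    by (rule le_less_trans) simp
  ultimately have "f \<in> hardy_space 2"
    by (simp add: hardy_space_def)
  then show "series_in_hardy 2 a"
    unfolding series_in_hardy_def using sums by (intro bexI[of _ f]) (auto simp: f_def)
qed

definition Lp_property :: "'w measure \<Rightarrow> real \<Rightarrow> (nat \<Rightarrow> 'w \<Rightarrow> complex) \<Rightarrow> bool" where
  "Lp_property M p X \<longleftrightarrow>
     (\<forall>a. series_in_hardy 2 a \<longrightarrow> (AE \<omega> in M. series_in_hardy p (\<lambda>n. a n * X n \<omega>)))"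

definition coefficient_multiplier_H2 :: "real \<Rightarrow> (nat \<Rightarrow> complex) \<Rightarrow> bool" where
  "coefficient_multiplier_H2 p l \<longleftrightarrow>
     (\<forall>a. series_in_hardy 2 a \<longrightarrow> series_in_hardy p (\<lambda>n. a n * l n))"

text \<open>A constant counts as a (degenerate) Gaussian.\<close>

definition gaussian_rv :: "'w measure \<Rightarrow> ('w \<Rightarrow> real) \<Rightarrow> bool" where
  "gaussian_rv M Y \<longleftrightarrow> Y \<in> borel_measurable M \<and>
     ((\<exists>\<mu> \<sigma>. 0 < \<sigma> \<and> distributed M lborel Y (normal_density \<mu> \<sigma>)) \<or>
      (\<exists>\<mu>. AE \<omega> in M. Y \<omega> = \<mu>))"

definition gaussian_process :: "'w measure \<Rightarrow> (nat \<Rightarrow> 'w \<Rightarrow> real) \<Rightarrow> bool" where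
  "gaussian_process M X \<longleftrightarrow>
     (\<forall>F c. finite F \<longrightarrow> gaussian_rv M (\<lambda>\<omega>. \<Sum>n\<in>F. c n * X n \<omega>))"

end

theory Submission
  imports Defs
begin

text \<open>Every finite linear combination of the variables \<open>X\<^sub>n\<close> is Gaussian, hence symmetric about
  its mean. By uniqueness of characteristic functions the sequences \<open>X\<^sub>n\<close> and \<open>2 E X\<^sub>n - X\<^sub>n\<close>
  have the same law on the space of real sequences. Membership of \<open>\<Sum>\<^sub>n a\<^sub>n x\<^sub>n z\<^sup>n\<close> in \<open>H\<^sup>p\<close> is a
  measurable condition on \<open>x\<close>, so both random series lie in \<open>H\<^sup>p\<close> almost surely once one does,
  and so does half their sum, which is the deterministic series with coefficients
  \<open>a\<^sub>n E X\<^sub>n\<close>. Everything else is the vector space structure of \<open>H\<^sup>p\<close>.\<close>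

section \<open>Uniqueness of characteristic functions under weights\<close>

text \<open>After division by its mass \<open>c\<close>, the weight is a probability density, and
  \<open>P\<close> is the law of \<open>W\<close> under that density. This puts weighted integrals
  within reach of \<open>Levy_uniqueness\<close>.\<close>

lemma weighted_law:
  fixes w W :: "'a \<Rightarrow> real"
  assumes w: "integrable M w" "\<And>x. 0 \<le> w x" and W[measurable]: "W \<in> borel_measurable M"
    and c: "0 < c" "c = (\<integral>x. w x \<partial>M)"
  obtains P where "real_distribution P"
    and "\<And>t. char P t = (\<integral>x. w x * cis (t * W x) \<partial>M) / c"
    and "\<And>B. B \<in> sets borel \<Longrightarrow> measure P B = (\<integral>x. w x * indicator B (W x) \<partial>M) / c"
proof
  define P where "P = distr (density M (\<lambda>x. ennreal (w x / c))) borel W"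
  have [measurable]: "w \<in> borel_measurable M" using w by simp
  have "emeasure (density M (\<lambda>x. ennreal (w x / c))) (space M) = (\<integral>\<^sup>+x. ennreal (w x / c) \<partial>M)"
    by (subst emeasure_density) (auto intro!: nn_integral_cong)
  also have "\<dots> = ennreal (\<integral>x. w x / c \<partial>M)"
    using w c(1) by (intro nn_integral_eq_integral) auto
  also have "\<dots> = 1"
    using c by simp
  finally have "prob_space (density M (\<lambda>x. ennreal (w x / c)))"
    by (intro prob_spaceI) simp
  then have "prob_space P"
    unfolding P_def by (intro prob_space.prob_space_distr) auto
  then show "real_distribution P"
    by (auto simp: real_distribution_def real_distribution_axioms_def P_def)
  \<comment> \<open>Vector-valued \<open>h\<close> covers both uses: the complex exponential for
    \<open>char\<close> and the real indicator for \<open>measure\<close>.\<close>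
  have *: "(\<integral>x. h x \<partial>P) = (\<integral>x. w x *\<^sub>R h (W x) \<partial>M) /\<^sub>R c"
    if [measurable]: "h \<in> borel_measurable borel"
    for h :: "real \<Rightarrow> 'd :: {banach, second_countable_topology}"
  proof -
    have "(\<integral>x. h x \<partial>P) = (\<integral>x. (w x / c) *\<^sub>R h (W x) \<partial>M)"
      unfolding P_def using w c(1)
      by (subst integral_distr) (auto intro!: integral_density)
    also have "\<dots> = (\<integral>x. (1 / c) *\<^sub>R w x *\<^sub>R h (W x) \<partial>M)"
      by simp
    finally show ?thesis by (simp only: integral_scaleR_right inverse_eq_divide)
  qed
  show "char P t = (\<integral>x. w x * cis (t * W x) \<partial>M) / c" for t
    unfolding char_def by (subst *) (simp_all add: cis_conv_exp scaleR_conv_of_real divide_inverse mult_ac)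
  show "measure P B = (\<integral>x. w x * indicator B (W x) \<partial>M) / c" if [measurable]: "B \<in> sets borel" for B
  proof -
    have "measure P B = (\<integral>x. indicator B x \<partial>P)"
      by (simp add: P_def)
    also have "\<dots> = (\<integral>x. w x * indicator B (W x) \<partial>M) / c"
      by (subst *) (simp_all add: divide_inverse mult_ac)
    finally show ?thesis .
  qed
qed

text \<open>The hypothesis at \<open>t = 0\<close> says that the weights have equal mass. If it is
  zero, both weights vanish almost everywhere; otherwise the normalised laws share their
  characteristic function and so coincide.\<close>

lemma integral_indicator_eq_of_cis_nonneg:
  fixes u Y :: "'a \<Rightarrow> real" and v Z :: "'b \<Rightarrow> real"
  assumes u: "integrable M u" "\<And>x. 0 \<le> u x" and v: "integrable N v" "\<And>x. 0 \<le> v x"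
    and Y: "Y \<in> borel_measurable M" and Z: "Z \<in> borel_measurable N"
    and eq: "\<And>t. (\<integral>x. u x * cis (t * Y x) \<partial>M) = (\<integral>x. v x * cis (t * Z x) \<partial>N)"
    and B: "B \<in> sets borel"
  shows "(\<integral>x. u x * indicator B (Y x) \<partial>M) = (\<integral>x. v x * indicator B (Z x) \<partial>N)"
proof -
  define c where "c = (\<integral>x. u x \<partial>M)"
  have cv: "c = (\<integral>x. v x \<partial>N)"
    using eq[of 0] by (simp add: c_def)
  show ?thesis
  proof (cases "c = 0")
    case True
    then have "AE x in M. u x = 0" "AE x in N. v x = 0"
      using integral_nonneg_eq_0_iff_AE[of M u] integral_nonneg_eq_0_iff_AE[of N v] u v
      by (auto simp: c_def cv[symmetric])
    then have "AE x in M. u x * indicator B (Y x) = 0" "AE x in N. v x * indicator B (Z x) = 0"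
      by (auto elim: eventually_mono)
    then show ?thesis
      by (simp add: integral_eq_zero_AE)
  next
    case False
    have "0 \<le> c" unfolding c_def using u by simp
    with False have c: "0 < c" by simp
    obtain P where P: "real_distribution P"
      "\<And>t. char P t = (\<integral>x. u x * cis (t * Y x) \<partial>M) / c"
      "measure P B = (\<integral>x. u x * indicator B (Y x) \<partial>M) / c"
      using weighted_law[OF u Y c c_def] B by metis
    obtain Q where Q: "real_distribution Q"
      "\<And>t. char Q t = (\<integral>x. v x * cis (t * Z x) \<partial>N) / c"
      "measure Q B = (\<integral>x. v x * indicator B (Z x) \<partial>N) / c"
      using weighted_law[OF v Z c cv] B by metis
    have "P = Q"
      using P Q by (intro Levy_uniqueness ext) (simp_all add: eq)
    then show ?thesis
      using P(3) Q(3) c by simp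
  qed
qed

text \<open>The dominating weights \<open>u\<close> and \<open>v\<close> make \<open>u + Re (c w)\<close> and \<open>v + Re (c w')\<close> nonnegative, which
  reduces complex weights to nonnegative ones.\<close>

lemma integral_indicator_eq_of_cis:
  fixes w :: "'a \<Rightarrow> complex" and w' :: "'b \<Rightarrow> complex" and Y u :: "'a \<Rightarrow> real" and Z v :: "'b \<Rightarrow> real"
  assumes w[measurable]: "w \<in> borel_measurable M" "w' \<in> borel_measurable N"
    and u: "integrable M u" "\<And>x. cmod (w x) \<le> u x" and v: "integrable N v" "\<And>x. cmod (w' x) \<le> v x"
    and Y[measurable]: "Y \<in> borel_measurable M" and Z[measurable]: "Z \<in> borel_measurable N"
    and equ: "\<And>t. (\<integral>x. u x * cis (t * Y x) \<partial>M) = (\<integral>x. v x * cis (t * Z x) \<partial>N)"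
    and eq: "\<And>t. (\<integral>x. w x * cis (t * Y x) \<partial>M) = (\<integral>x. w' x * cis (t * Z x) \<partial>N)"
    and B[measurable]: "B \<in> sets borel"
  shows "(\<integral>x. w x * indicator B (Y x) \<partial>M) = (\<integral>x. w' x * indicator B (Z x) \<partial>N)"
proof -
  have int_mult: "integrable L (\<lambda>x. h x * g x)"
    if "integrable L k" "\<And>x. cmod (h x) \<le> k x" "h \<in> borel_measurable L" "g \<in> borel_measurable L"
      "\<And>x. cmod (g x) \<le> 1"
    for L :: "'c measure" and h g k
  proof (rule Bochner_Integration.integrable_bound[OF that(1)])
    show "AE x in L. cmod (h x * g x) \<le> norm (k x)"
    proof (intro AE_I2)
      fix x
      have "cmod (h x * g x) \<le> cmod (h x)"
        using that(5)[of x] by (simp add: norm_mult mult_left_le)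
      then show "cmod (h x * g x) \<le> norm (k x)" using that(2)[of x] by simp
    qed
  qed (use that in measurable)
  have nonneg: "0 \<le> u x" "0 \<le> v y" for x y
    using u(2)[of x] v(2)[of y] norm_ge_zero order_trans by blast+
  have [measurable]: "cis \<in> borel_measurable borel"
    by (intro borel_measurable_continuous_onI continuous_intros)
  \<comment> \<open>The unit scalar \<open>c\<close> treats both parts at once: \<open>c = 1\<close>
    yields the real part and \<open>c = - \<i>\<close> the imaginary part, since Re (-i z) = Im
    z.\<close>
  have Re: "(\<integral>x. Re (c * w x) * indicator B (Y x) \<partial>M) = (\<integral>x. Re (c * w' x) * indicator B (Z x) \<partial>N)"
    if c: "cmod c = 1" for c
  proof -
    have le: "cmod (c * w x) \<le> u x" "cmod (c * w' y) \<le> v y" for x y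
      using u v c by (auto simp: norm_mult)
    have Re_le: "\<bar>Re (c * w x)\<bar> \<le> u x" "\<bar>Re (c * w' y)\<bar> \<le> v y" for x y
      using le abs_Re_le_cmod order_trans by blast+
    have intR: "integrable M (\<lambda>x. Re (c * w x))" "integrable N (\<lambda>x. Re (c * w' x))"
      by (auto intro!: Bochner_Integration.integrable_bound[OF u(1)]
          Bochner_Integration.integrable_bound[OF v(1)] AE_I2 order_trans[OF _ abs_ge_self] Re_le
          simp del: times_complex.sel)
    \<comment> \<open>The real part is half the sum of a number and its conjugate. Conjugating
      reverses the sign in \<open>cis\<close>, so the transform of the real weight involves the
      transform of \<open>h\<close> at both \<open>t\<close> and \<open>- t\<close>.\<close>
    have split: "(\<integral>x. complex_of_real (k x + Re (c * h x)) * cis (t * W x) \<partial>L) =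
        (\<integral>x. k x * cis (t * W x) \<partial>L) +
        (c * (\<integral>x. h x * cis (t * W x) \<partial>L) + cnj (c * (\<integral>x. h x * cis (- t * W x) \<partial>L))) / 2"
      if k: "integrable L k" "\<And>x. cmod (h x) \<le> k x" and [measurable]: "h \<in> borel_measurable L"
        "W \<in> borel_measurable L"
      for L :: "'c measure" and k h W t
    proof -
      have k0: "0 \<le> k x" for x using k(2)[of x] norm_ge_zero order_trans by blast
      have [measurable]: "k \<in> borel_measurable L" using k by auto
      have i: "integrable L (\<lambda>x. complex_of_real (k x) * cis (t * W x))"
        "integrable L (\<lambda>x. h x * cis (t * W x))" "integrable L (\<lambda>x. h x * cis (- t * W x))"
        using k k0 by (auto intro!: int_mult[of L k])
      have "(\<integral>x. complex_of_real (k x + Re (c * h x)) * cis (t * W x) \<partial>L) =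
          (\<integral>x. k x * cis (t * W x) + (c * (h x * cis (t * W x)) + cnj (c * (h x * cis (- t * W x)))) / 2 \<partial>L)"
      proof (rule Bochner_Integration.integral_cong[OF refl])
        fix x
        have "complex_of_real (Re (c * h x)) = (c * h x + cnj (c * h x)) / 2"
          by (simp only: complex_add_cnj) simp
        then show "complex_of_real (k x + Re (c * h x)) * cis (t * W x) =
            k x * cis (t * W x) + (c * (h x * cis (t * W x)) + cnj (c * (h x * cis (- t * W x)))) / 2"
          by (simp only: of_real_add ring_distribs) (simp add: cis_cnj field_simps)
      qed
      also have "\<dots> = (\<integral>x. k x * cis (t * W x) \<partial>L) +
        (c * (\<integral>x. h x * cis (t * W x) \<partial>L) + cnj (c * (\<integral>x. h x * cis (- t * W x) \<partial>L))) / 2"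
        using i by (simp del: complex_cnj_mult add: integral_cnj integrable_cnj)
      finally show ?thesis .
    qed
    have ind: "integrable L (\<lambda>x. k x * indicator B (W x))"
      if "integrable L k" and [measurable]: "W \<in> borel_measurable L"
      for L :: "'c measure" and k W :: "'c \<Rightarrow> real"
      by (rule Bochner_Integration.integrable_bound[OF that(1)]) (use that(1) in \<open>auto simp: indicator_def\<close>)
    \<comment> \<open>The nonnegative case applies to \<open>u + Re (c w)\<close> and to
      \<open>u\<close> alone; the claim is the difference of the two identities.\<close>
    have "(\<integral>x. (u x + Re (c * w x)) * indicator B (Y x) \<partial>M) =
        (\<integral>x. (v x + Re (c * w' x)) * indicator B (Z x) \<partial>N)"
    proof (rule integral_indicator_eq_of_cis_nonneg)
      show "0 \<le> u x + Re (c * w x)" "0 \<le> v y + Re (c * w' y)" for x y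
        using Re_le(1)[of x] Re_le(2)[of y] by (auto simp: abs_le_iff)
      show "(\<integral>x. complex_of_real (u x + Re (c * w x)) * cis (t * Y x) \<partial>M) =
          (\<integral>x. complex_of_real (v x + Re (c * w' x)) * cis (t * Z x) \<partial>N)" for t
        by (subst (1 2) split) (use u v equ eq[of t] eq[of "- t"] in simp_all)
    qed (use u v intR in auto)
    moreover have "(\<integral>x. u x * indicator B (Y x) \<partial>M) = (\<integral>x. v x * indicator B (Z x) \<partial>N)"
      by (rule integral_indicator_eq_of_cis_nonneg) (use u v nonneg equ in auto)
    moreover have "(\<integral>x. (u x + Re (c * w x)) * indicator B (Y x) \<partial>M) =
        (\<integral>x. u x * indicator B (Y x) \<partial>M) + (\<integral>x. Re (c * w x) * indicator B (Y x) \<partial>M)"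
      unfolding distrib_right by (intro Bochner_Integration.integral_add ind u intR Y)
    moreover have "(\<integral>x. (v x + Re (c * w' x)) * indicator B (Z x) \<partial>N) =
        (\<integral>x. v x * indicator B (Z x) \<partial>N) + (\<integral>x. Re (c * w' x) * indicator B (Z x) \<partial>N)"
      unfolding distrib_right by (intro Bochner_Integration.integral_add ind v intR Z)
    ultimately show ?thesis
      by linarith
  qed
  have i: "integrable M (\<lambda>x. w x * indicator B (Y x))" "integrable N (\<lambda>x. w' x * indicator B (Z x))"
    by (rule int_mult[of _ u] int_mult[of _ v]; use u v in \<open>simp add: indicator_def\<close>)+
  have *: "Re (a * indicator S y) = Re a * indicator S y" "Im (a * indicator S y) = Im a * indicator S y"
    for a :: complex and S and y :: real
    by (simp_all add: indicator_def)
  show ?thesis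
  proof (rule complex_eqI)
    show "Re (\<integral>x. w x * indicator B (Y x) \<partial>M) = Re (\<integral>x. w' x * indicator B (Z x) \<partial>N)"
      using Re[of 1] by (simp only: integral_Re[OF i(1), symmetric] integral_Re[OF i(2), symmetric] *) simp
    show "Im (\<integral>x. w x * indicator B (Y x) \<partial>M) = Im (\<integral>x. w' x * indicator B (Z x) \<partial>N)"
      using Re[of "- \<i>"] by (simp only: integral_Im[OF i(1), symmetric] integral_Im[OF i(2), symmetric] *) simp
  qed
qed

section \<open>Hardy spaces as vector spaces\<close>

text \<open>Both summands are at most the maximum. The resulting constant serves every
  \<open>p > 0\<close>, including p < 1, where the triangle inequality for the p-norm fails.\<close>

lemma powr_add_le:
  fixes x y p :: real
  assumes "0 \<le> x" "0 \<le> y" "0 < p"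
  shows "(x + y) powr p \<le> 2 powr p * (x powr p + y powr p)"
proof -
  have "(x + y) powr p \<le> (2 * max x y) powr p"
    using assms by (intro powr_mono2) auto
  also have "\<dots> = 2 powr p * max x y powr p"
    using assms by (simp add: powr_mult)
  also have "\<dots> \<le> 2 powr p * (x powr p + y powr p)"
    by (intro mult_left_mono) (auto simp: max_def)
  finally show ?thesis .
qed

text \<open>The p-th power of the integral mean over the circle of radius \<open>r\<close>; leaving
  out the p-th root does not affect finiteness of the supremum.\<close>

definition circle_mean :: "real \<Rightarrow> (complex \<Rightarrow> complex) \<Rightarrow> real \<Rightarrow> ennreal" where
  "circle_mean p f r =
     (\<integral>\<^sup>+\<theta>\<in>{0..2*pi}. ennreal (cmod (f (complex_of_real r * cis \<theta>)) powr p / (2*pi)) \<partial>lborel)"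

lemma hardy_space_iff:
  "f \<in> hardy_space p \<longleftrightarrow> f holomorphic_on ball 0 1 \<and> (SUP r\<in>{0<..<1}. circle_mean p f r) < \<infinity>"
  by (simp add: hardy_space_def circle_mean_def)

lemma borel_measurable_circle:
  assumes "f holomorphic_on ball 0 1" "0 < r" "r < 1"
  shows "(\<lambda>\<theta>. f (complex_of_real r * cis \<theta>)) \<in> borel_measurable borel"
proof (rule borel_measurable_continuous_onI)
  have "continuous_on UNIV (\<lambda>\<theta>. complex_of_real r * cis \<theta>)"
    by (intro continuous_intros)
  moreover have "(\<lambda>\<theta>. complex_of_real r * cis \<theta>) ` UNIV \<subseteq> ball 0 1"
    using assms by (auto simp: norm_mult)
  ultimately show "continuous_on UNIV (\<lambda>\<theta>. f (complex_of_real r * cis \<theta>))"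
    using holomorphic_on_imp_continuous_on[OF assms(1)] continuous_on_compose2 by blast
qed

lemma hardy_space_add:
  assumes f: "f \<in> hardy_space p" and g: "g \<in> hardy_space p" and p: "0 < p"
  shows "(\<lambda>z. f z + g z) \<in> hardy_space p"
proof -
  let ?C = "\<lambda>f. SUP r\<in>{0<..<1}. circle_mean p f r"
  have le: "circle_mean p (\<lambda>z. f z + g z) r \<le> ennreal (2 powr p) * (?C f + ?C g)"
    if r: "r \<in> {0<..<1}" for r
  proof -
    have [measurable]: "(\<lambda>\<theta>. f (complex_of_real r * cis \<theta>)) \<in> borel_measurable borel"
      "(\<lambda>\<theta>. g (complex_of_real r * cis \<theta>)) \<in> borel_measurable borel"
      using f g r by (auto simp: hardy_space_iff intro!: borel_measurable_circle)
    have "circle_mean p (\<lambda>z. f z + g z) r \<le>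
        (\<integral>\<^sup>+\<theta>. ennreal (2 powr p) *
          (ennreal (cmod (f (complex_of_real r * cis \<theta>)) powr p / (2*pi)) * indicator {0..2*pi} \<theta> +
           ennreal (cmod (g (complex_of_real r * cis \<theta>)) powr p / (2*pi)) * indicator {0..2*pi} \<theta>) \<partial>lborel)"
      unfolding circle_mean_def
    proof (rule nn_integral_mono)
      fix \<theta>
      let ?x = "f (complex_of_real r * cis \<theta>)" and ?y = "g (complex_of_real r * cis \<theta>)"
      have "cmod (?x + ?y) powr p \<le> (cmod ?x + cmod ?y) powr p"
        using p by (intro powr_mono2 norm_triangle_ineq) auto
      also have "\<dots> \<le> 2 powr p * (cmod ?x powr p + cmod ?y powr p)"
        using p by (intro powr_add_le) auto
      finally have "cmod (?x + ?y) powr p / (2*pi) \<le>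
          2 powr p * (cmod ?x powr p / (2*pi) + cmod ?y powr p / (2*pi))"
        by (simp add: field_simps)
      then have "ennreal (cmod (?x + ?y) powr p / (2*pi)) \<le>
          ennreal (2 powr p) * (ennreal (cmod ?x powr p / (2*pi)) + ennreal (cmod ?y powr p / (2*pi)))"
        by (simp add: ennreal_leI flip: ennreal_plus ennreal_mult)
      then show "ennreal (cmod (?x + ?y) powr p / (2*pi)) * indicator {0..2*pi} \<theta> \<le>
          ennreal (2 powr p) * (ennreal (cmod ?x powr p / (2*pi)) * indicator {0..2*pi} \<theta> +
            ennreal (cmod ?y powr p / (2*pi)) * indicator {0..2*pi} \<theta>)"
        by (auto simp: indicator_def)
    qed
    also have "\<dots> = ennreal (2 powr p) * (circle_mean p f r + circle_mean p g r)"
      unfolding circle_mean_def by (subst nn_integral_cmult) (simp_all add: nn_integral_add)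
    also have "\<dots> \<le> ennreal (2 powr p) * (?C f + ?C g)"
      using r by (intro mult_left_mono add_mono SUP_upper) auto
    finally show ?thesis .
  qed
  have "?C (\<lambda>z. f z + g z) \<le> ennreal (2 powr p) * (?C f + ?C g)"
    using le by (rule SUP_least)
  also have "\<dots> < \<infinity>"
    using f g by (simp add: hardy_space_iff ennreal_mult_less_top)
  finally show ?thesis
    using f g by (auto simp: hardy_space_iff intro: holomorphic_intros)
qed

lemma hardy_space_cmult:
  assumes f: "f \<in> hardy_space p"
  shows "(\<lambda>z. c * f z) \<in> hardy_space p"
proof -
  have eq: "circle_mean p (\<lambda>z. c * f z) r = ennreal (cmod c powr p) * circle_mean p f r"
    if r: "r \<in> {0<..<1}" for r
  proof -
    have [measurable]: "(\<lambda>\<theta>. f (complex_of_real r * cis \<theta>)) \<in> borel_measurable borel"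
      using f r by (auto simp: hardy_space_iff intro!: borel_measurable_circle)
    show ?thesis
      unfolding circle_mean_def
      by (subst nn_integral_cmult[symmetric])
        (auto intro!: nn_integral_cong simp: norm_mult powr_mult indicator_def simp flip: ennreal_mult)
  qed
  then have "(SUP r\<in>{0<..<1}. circle_mean p (\<lambda>z. c * f z) r) =
      ennreal (cmod c powr p) * (SUP r\<in>{0<..<1}. circle_mean p f r)"
    by (simp add: SUP_mult_left_ennreal)
  also have "\<dots> < \<infinity>"
    using f by (simp add: hardy_space_iff ennreal_mult_less_top)
  finally show ?thesis
    using f by (auto simp: hardy_space_iff intro: holomorphic_intros)
qed

lemma series_in_hardy_add:
  assumes "series_in_hardy p a" "series_in_hardy p b" "0 < p"
  shows "series_in_hardy p (\<lambda>n. a n + b n)"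
proof -
  obtain f g where "f \<in> hardy_space p" "g \<in> hardy_space p"
    "\<forall>z\<in>ball 0 1. (\<lambda>n. a n * z ^ n) sums f z" "\<forall>z\<in>ball 0 1. (\<lambda>n. b n * z ^ n) sums g z"
    using assms by (auto simp: series_in_hardy_def)
  then show ?thesis
    using assms(3) unfolding series_in_hardy_def
    by (intro bexI[of _ "\<lambda>z. f z + g z"]) (auto simp: ring_distribs intro: sums_add hardy_space_add)
qed

lemma series_in_hardy_cmult:
  assumes "series_in_hardy p a"
  shows "series_in_hardy p (\<lambda>n. c * a n)"
proof -
  obtain f where "f \<in> hardy_space p" "\<forall>z\<in>ball 0 1. (\<lambda>n. a n * z ^ n) sums f z"
    using assms by (auto simp: series_in_hardy_def)
  then show ?thesis
    unfolding series_in_hardy_def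
    by (intro bexI[of _ "\<lambda>z. c * f z"]) (auto simp: mult.assoc intro: sums_mult hardy_space_cmult)
qed

section \<open>Rational radii and measurability of membership in H^p\<close>

text \<open>Fatou's lemma along rational radii tending to \<open>r\<close>: by continuity of
  \<open>f\<close> the integrands converge pointwise, so the mean at \<open>r\<close> is at most the
  lower limit of the means at these radii.\<close>

lemma circle_mean_le_SUP_Rats:
  assumes f: "f holomorphic_on ball 0 1" and p: "0 < p" and r: "0 < r" "r < 1"
  shows "circle_mean p f r \<le> (SUP q\<in>\<rat>\<inter>{0<..<1}. circle_mean p f q)"
proof -
  \<comment> \<open>The lower bound keeps the radii positive, the minimum with 1 keeps them inside
    the disk, and the shrinking margin forces convergence to \<open>r\<close>.\<close>
  have "\<exists>q\<in>\<rat>. r < q \<and> q < min 1 (r + inverse (real (Suc k)))" for k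
    using r by (intro Rats_dense_in_real) auto
  then obtain q where q: "\<And>k. q k \<in> \<rat>" "\<And>k. r < q k" "\<And>k. q k < 1"
    "\<And>k. q k < r + inverse (real (Suc k))"
    by (metis min_less_iff_conj)
  have q0: "0 < q k" for k using r q(2)[of k] by simp
  have qr: "q \<longlonglongrightarrow> r"
  proof (rule tendsto_sandwich[of "\<lambda>_. r" _ _ "\<lambda>k. r + inverse (real (Suc k))"])
    show "(\<lambda>k. r + inverse (real (Suc k))) \<longlonglongrightarrow> r"
      using tendsto_add[OF tendsto_const LIMSEQ_inverse_real_of_nat, of r] by simp
    show "(\<lambda>_. r) \<longlonglongrightarrow> r" by simp
  qed (use q(2,4) in \<open>auto intro!: always_eventually less_imp_le\<close>)
  let ?h = "\<lambda>r \<theta>. ennreal (cmod (f (complex_of_real r * cis \<theta>)) powr p / (2*pi)) * indicator {0..2*pi} \<theta>"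
  have lim: "(\<lambda>k. ?h (q k) \<theta>) \<longlonglongrightarrow> ?h r \<theta>" for \<theta>
  proof -
    have "isCont f (complex_of_real r * cis \<theta>)"
      using f r by (intro continuous_on_interior[OF holomorphic_on_imp_continuous_on])
        (auto simp: norm_mult)
    then have "(\<lambda>k. f (complex_of_real (q k) * cis \<theta>)) \<longlonglongrightarrow> f (complex_of_real r * cis \<theta>)"
      by (rule isCont_tendsto_compose) (intro tendsto_intros qr)
    \<comment> \<open>At a zero of \<open>f\<close> the base of \<open>powr\<close> tends to 0,
      where continuity of the power rests on \<open>p > 0\<close>.\<close>
    then have "(\<lambda>k. cmod (f (complex_of_real (q k) * cis \<theta>)) powr p / (2*pi)) \<longlonglongrightarrow>
        cmod (f (complex_of_real r * cis \<theta>)) powr p / (2*pi)"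
      using p by (intro tendsto_divide tendsto_powr' tendsto_norm tendsto_const) auto
    then have "(\<lambda>k. ennreal (cmod (f (complex_of_real (q k) * cis \<theta>)) powr p / (2*pi))) \<longlonglongrightarrow>
        ennreal (cmod (f (complex_of_real r * cis \<theta>)) powr p / (2*pi))"
      by (rule tendsto_ennrealI)
    then show ?thesis by (cases "\<theta> \<in> {0..2*pi}") auto
  qed
  have [measurable]: "(\<lambda>\<theta>. f (complex_of_real (q k) * cis \<theta>)) \<in> borel_measurable borel" for k
    using f q q0 by (intro borel_measurable_circle) auto
  have "circle_mean p f r = (\<integral>\<^sup>+\<theta>. liminf (\<lambda>k. ?h (q k) \<theta>) \<partial>lborel)"
    unfolding circle_mean_def
    by (intro nn_integral_cong lim_imp_Liminf[symmetric] lim) simp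
  also have "\<dots> \<le> liminf (\<lambda>k. circle_mean p f (q k))"
    unfolding circle_mean_def by (rule nn_integral_liminf) measurable
  also have "\<dots> \<le> (SUP q\<in>\<rat>\<inter>{0<..<1}. circle_mean p f q)"
    using q q0 by (intro Liminf_le always_eventually allI SUP_upper) auto
  finally show ?thesis .
qed

text \<open>A description of \<open>H\<^sup>p\<close> by countably many conditions, which makes membership measurable.\<close>

lemma series_in_hardy_iff_Rats:
  assumes p: "0 < p"
  shows "series_in_hardy p a \<longleftrightarrow>
    (\<forall>q\<in>\<rat>\<inter>{0<..<1::real}. summable (\<lambda>n. a n * complex_of_real q ^ n)) \<and>
    (SUP q\<in>\<rat>\<inter>{0<..<1}. circle_mean p (\<lambda>z. \<Sum>n. a n * z ^ n) q) < \<infinity>" (is "_ \<longleftrightarrow> ?R")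
proof
  assume "series_in_hardy p a"
  then obtain f where f: "f \<in> hardy_space p" "\<And>z. z \<in> ball 0 1 \<Longrightarrow> (\<lambda>n. a n * z ^ n) sums f z"
    by (auto simp: series_in_hardy_def)
  have "circle_mean p (\<lambda>z. \<Sum>n. a n * z ^ n) q = circle_mean p f q" if "q \<in> {0<..<1}" for q
  proof -
    have "(\<Sum>n. a n * (complex_of_real q * cis \<theta>) ^ n) = f (complex_of_real q * cis \<theta>)" for \<theta>
      using that by (intro sums_unique[symmetric] f(2)) (auto simp: norm_mult)
    then show ?thesis by (simp add: circle_mean_def)
  qed
  then have "(SUP q\<in>\<rat>\<inter>{0<..<1}. circle_mean p (\<lambda>z. \<Sum>n. a n * z ^ n) q) \<le>
      (SUP q\<in>{0<..<1}. circle_mean p f q)"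
    by (intro SUP_mono) auto
  also have "\<dots> < \<infinity>"
    using f by (simp add: hardy_space_iff)
  finally show ?R
    by (auto intro!: sums_summable[OF f(2)])
next
  assume R: ?R
  define f where "f z = (\<Sum>n. a n * z ^ n)" for z
  have sums: "(\<lambda>n. a n * z ^ n) sums f z" if z: "z \<in> ball 0 1" for z
  proof -
    \<comment> \<open>Convergence of a power series at one rational radius beyond |z| carries over
      to \<open>z\<close>, so rational points of the positive axis control the whole disk.\<close>
    obtain q where q: "q \<in> \<rat>" "cmod z < q" "q < 1"
      using z Rats_dense_in_real[of "cmod z" 1] by auto
    then have "q \<in> \<rat>\<inter>{0<..<1}" using norm_ge_zero[of z] by (auto simp del: norm_ge_zero)
    then have "summable (\<lambda>n. a n * complex_of_real q ^ n)" using R by blast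
    then have "summable (\<lambda>n. a n * z ^ n)"
      by (rule powser_inside) (use q in auto)
    then show ?thesis by (simp add: f_def summable_sums)
  qed
  have hol: "f holomorphic_on ball 0 1"
    using power_series_holomorphic[of 0 1 a f] sums by simp
  have "(SUP r\<in>{0<..<1}. circle_mean p f r) \<le> (SUP q\<in>\<rat>\<inter>{0<..<1}. circle_mean p f q)"
    using hol p by (intro SUP_least circle_mean_le_SUP_Rats) auto
  also have "\<dots> < \<infinity>"
    using R by (simp add: f_def[abs_def])
  finally show "series_in_hardy p a"
    using hol sums unfolding series_in_hardy_def
    by (intro bexI[of _ f]) (auto simp: hardy_space_iff)
qed

text \<open>Each of the countably many conditions is measurable: summability as a Cauchy condition
  on partial sums, and the circle mean as a parameter integral of a jointly measurable
  function.\<close>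

lemma sets_Collect_series_in_hardy:
  fixes c :: "nat \<Rightarrow> 'a \<Rightarrow> complex"
  assumes p: "0 < p" and c[measurable]: "\<And>n. c n \<in> borel_measurable N"
  shows "{x\<in>space N. series_in_hardy p (\<lambda>n. c n x)} \<in> sets N"
proof -
  have cnt: "countable (\<rat> \<inter> {0<..<1::real})"
    using countable_rat by blast
  have 1: "{x\<in>space N. summable (\<lambda>n. c n x * complex_of_real q ^ n)} \<in> sets N" for q
    unfolding summable_iff_convergent Cauchy_convergent_iff[symmetric] by measurable
  have [measurable]: "(\<lambda>x. circle_mean p (\<lambda>z. \<Sum>n. c n x * z ^ n) q) \<in> borel_measurable N" for q
    unfolding circle_mean_def
  proof (rule lborel.borel_measurable_nn_integral)
    have [measurable]: "cis \<in> borel_measurable borel"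
      by (intro borel_measurable_continuous_onI continuous_intros)
    show "(\<lambda>(x, \<theta>). ennreal (cmod (\<Sum>n. c n x * (complex_of_real q * cis \<theta>) ^ n) powr p / (2*pi)) *
        indicator {0..2*pi} \<theta>) \<in> borel_measurable (N \<Otimes>\<^sub>M lborel)"
      by measurable
  qed
  have 2: "{x\<in>space N. (SUP q\<in>\<rat>\<inter>{0<..<1}. circle_mean p (\<lambda>z. \<Sum>n. c n x * z ^ n) q) < \<infinity>} \<in> sets N"
    using cnt by measurable
  \<comment> \<open>Density of the rationals shows that the index set is nonempty; an empty
    intersection would be the whole type instead of \<open>space N\<close>.\<close>
  have "(\<Inter>q\<in>\<rat>\<inter>{0<..<1}. {x\<in>space N. summable (\<lambda>n. c n x * complex_of_real q ^ n)}) \<in> sets N"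
    using 1 Rats_dense_in_real[of 0 1] by (intro sets.countable_INT' cnt) auto
  also have "(\<Inter>q\<in>\<rat>\<inter>{0<..<1}. {x\<in>space N. summable (\<lambda>n. c n x * complex_of_real q ^ n)}) =
      {x\<in>space N. \<forall>q\<in>\<rat>\<inter>{0<..<1}. summable (\<lambda>n. c n x * complex_of_real q ^ n)}"
    using Rats_dense_in_real[of 0 1] by auto
  finally show ?thesis
    unfolding series_in_hardy_iff_Rats[OF p] by (intro sets.sets_Collect_conj 2)
qed

section \<open>Laws of processes from characteristic functions\<close>

text \<open>The law of a real process is determined by the characteristic functions of its finite linear
  combinations. Only the one-dimensional uniqueness theorem is available, so the factors
  \<open>exp (i t X\<^sub>k)\<close> are traded one at a time for indicators of \<open>X\<^sub>k \<in> A\<^sub>k\<close>, the remaining factors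
  acting as a complex weight.\<close>

lemma distr_PiM_eq_of_cis:
  fixes X :: "'i \<Rightarrow> 'a \<Rightarrow> real" and Y :: "'i \<Rightarrow> 'b \<Rightarrow> real"
  assumes M: "prob_space M" and N: "prob_space N"
    and X[measurable]: "\<And>i. X i \<in> borel_measurable M"
    and Y[measurable]: "\<And>i. Y i \<in> borel_measurable N"
    and eq: "\<And>F c. finite F \<Longrightarrow>
      (\<integral>x. cis (\<Sum>i\<in>F. c i * X i x) \<partial>M) = (\<integral>x. cis (\<Sum>i\<in>F. c i * Y i x) \<partial>N)"
  shows "distr M (\<Pi>\<^sub>M i\<in>UNIV. borel) (\<lambda>x i. X i x) = distr N (\<Pi>\<^sub>M i\<in>UNIV. borel) (\<lambda>x i. Y i x)"
proof -
  interpret M: prob_space M by fact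
  interpret N: prob_space N by fact
  have [measurable]: "cis \<in> borel_measurable borel"
    by (intro borel_measurable_continuous_onI continuous_intros)
  \<comment> \<open>\<open>F\<close> and \<open>c\<close> stay arbitrary in the induction because
    trading a factor enlarges the linear form by a multiple of the new coordinate. With
    \<open>F = {}\<close> only indicators remain, which are the cylinder probabilities.\<close>
  have mixed: "(\<integral>x. (\<Prod>i\<in>J. indicator (A i) (X i x)) * cis (\<Sum>i\<in>F. c i * X i x) \<partial>M) =
      (\<integral>x. (\<Prod>i\<in>J. indicator (A i) (Y i x)) * cis (\<Sum>i\<in>F. c i * Y i x) \<partial>N)"
    if "finite J" "finite F" "\<And>i. i \<in> J \<Longrightarrow> A i \<in> sets borel" for J F A c
    using that
  proof (induction J arbitrary: F c rule: finite_induct)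
    case empty
    then show ?case by (simp add: eq)
  next
    case (insert k J)
    note [measurable] = insert.prems(2)
    have [simp]: "finite F" using insert.prems by simp
    let ?PX = "\<lambda>x. \<Prod>i\<in>J. indicator (A i) (X i x)" and ?PY = "\<lambda>x. \<Prod>i\<in>J. indicator (A i) (Y i x)"
    \<comment> \<open>Coefficients of the form \<open>c\<close> plus \<open>t\<close> times
      coordinate \<open>k\<close>. The index \<open>k\<close> may already lie in \<open>F\<close>,
      so the contributions are added.\<close>
    define d where "d t i = (if i \<in> F then c i else 0) + (if i = k then t else 0)" for t i
    have d: "(\<Sum>i\<in>insert k F. d t i * z i) = (\<Sum>i\<in>F. c i * z i) + t * z k" for t and z :: "'i \<Rightarrow> real"
    proof -
      have "(\<Sum>i\<in>insert k F. d t i * z i) =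
          (\<Sum>i\<in>insert k F. if i \<in> F then c i * z i else 0) + (\<Sum>i\<in>insert k F. if i = k then t * z i else 0)"
        unfolding sum.distrib[symmetric] by (intro sum.cong) (auto simp: d_def algebra_simps)
      also have "(\<Sum>i\<in>insert k F. if i \<in> F then c i * z i else 0) = (\<Sum>i\<in>F. c i * z i)"
        by (rule sum.mono_neutral_cong_right) auto
      also have "(\<Sum>i\<in>insert k F. if i = k then t * z i else 0) = t * z k"
        by (simp add: sum.delta)
      finally show ?thesis .
    qed
    have mult: "prod (\<lambda>i. indicator (A i) (z i)) (insert k J) * cis s =
        prod (\<lambda>i. indicator (A i) (z i)) J * cis s * indicator (A k) (z k)" for z :: "'i \<Rightarrow> real" and s
      using insert.hyps by simp
    have norm: "cmod (prod (\<lambda>i. indicator (A i) (z i)) J) \<le> prod (\<lambda>i. indicator (A i) (z i)) J"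
      for z :: "'i \<Rightarrow> real"
      unfolding prod_norm[symmetric] by (intro prod_mono) (auto simp: indicator_def)
    have of_real: "complex_of_real (prod (\<lambda>i. indicator (A i) (z i)) J) = prod (\<lambda>i. indicator (A i) (z i)) J"
      for z :: "'i \<Rightarrow> real"
      unfolding of_real_prod by (intro prod.cong) (auto simp: indicator_def)
    have prod_le_1: "\<bar>prod (\<lambda>i. indicator (A i) (z i)) J\<bar> \<le> (1::real)" for z :: "'i \<Rightarrow> real"
      unfolding abs_prod by (intro prod_le_1) (auto simp: indicator_def)
    \<comment> \<open>The complex weight is the product of the old indicators times
      \<open>cis\<close> of the linear form, dominated by that product. The induction hypothesis is
      used twice: with \<open>{k}\<close> for the dominating weight and with
      \<open>insert k F\<close> for the complex one.\<close>
    show ?case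
      unfolding mult
    proof (rule integral_indicator_eq_of_cis)
      show "integrable M (\<lambda>x. \<Prod>i\<in>J. indicator (A i) (X i x) :: real)"
        by (rule M.integrable_const_bound[of _ 1]) (auto simp: prod_le_1)
      show "integrable N (\<lambda>x. \<Prod>i\<in>J. indicator (A i) (Y i x) :: real)"
        by (rule N.integrable_const_bound[of _ 1]) (auto simp: prod_le_1)
      show "(\<integral>x. complex_of_real (\<Prod>i\<in>J. indicator (A i) (X i x)) * cis (t * X k x) \<partial>M) =
          (\<integral>x. complex_of_real (\<Prod>i\<in>J. indicator (A i) (Y i x)) * cis (t * Y k x) \<partial>N)" for t
        unfolding of_real using insert.IH[of "{k}" "\<lambda>_. t"] insert.prems by simp
      show "(\<integral>x. ?PX x * cis (\<Sum>i\<in>F. c i * X i x) * cis (t * X k x) \<partial>M) =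
          (\<integral>x. ?PY x * cis (\<Sum>i\<in>F. c i * Y i x) * cis (t * Y k x) \<partial>N)" for t
        using insert.IH[of "insert k F" "d t"] insert.prems by (simp only: d mult.assoc cis_mult) simp
    qed (use insert.prems in \<open>auto simp: norm_mult norm\<close>)
  qed
  show ?thesis
  \<comment> \<open>Two finite measures on the product space agree once they agree on cylinders over
    finitely many coordinates.\<close>
  proof (rule measure_eqI_PiM_infinite)
    fix A :: "'i \<Rightarrow> real set" and J
    assume J: "finite J" and A: "\<And>i. i \<in> J \<Longrightarrow> A i \<in> sets (borel :: real measure)"
    let ?E = "prod_emb UNIV (\<lambda>_. borel) J (Pi\<^sub>E J A)"
    have E[measurable]: "?E \<in> sets (\<Pi>\<^sub>M i\<in>UNIV. borel)"
      using J A by (intro sets_PiM_I) auto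
    \<comment> \<open>The factor \<open>cis\<close> of an empty sum equals 1; it is written out to
      match \<open>mixed\<close>.\<close>
    have prob: "complex_of_real (measure (distr L (\<Pi>\<^sub>M i\<in>UNIV. borel) (\<lambda>x i. Z i x)) ?E) =
        (\<integral>x. (\<Prod>i\<in>J. indicator (A i) (Z i x)) * cis (\<Sum>i\<in>{}. 0 * Z i x) \<partial>L)"
      if [measurable]: "\<And>i. Z i \<in> borel_measurable L" for L :: "'c measure" and Z
    proof -
      have "complex_of_real (measure (distr L (\<Pi>\<^sub>M i\<in>UNIV. borel) (\<lambda>x i. Z i x)) ?E) =
          complex_of_real (\<integral>x. indicator ((\<lambda>x i. Z i x) -` ?E \<inter> space L) x \<partial>L)"
        by (simp add: measure_distr measurable_abs_UNIV)
      also have "\<dots> = (\<integral>x. complex_of_real (indicator ((\<lambda>x i. Z i x) -` ?E \<inter> space L) x) \<partial>L)"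
        by (rule integral_complex_of_real[symmetric])
      also have "\<dots> = (\<integral>x. (\<Prod>i\<in>J. indicator (A i) (Z i x)) * cis (\<Sum>i\<in>{}. 0 * Z i x) \<partial>L)"
      proof (rule Bochner_Integration.integral_cong[OF refl])
        fix x assume "x \<in> space L"
        then show "complex_of_real (indicator ((\<lambda>x i. Z i x) -` ?E \<inter> space L) x) =
            (\<Prod>i\<in>J. indicator (A i) (Z i x)) * cis (\<Sum>i\<in>{}. 0 * Z i x)"
          using J by (auto simp: indicator_def prod_emb_def PiE_iff intro!: prod_zero)
      qed
      finally show ?thesis .
    qed
    have "complex_of_real (measure (distr M (\<Pi>\<^sub>M i\<in>UNIV. borel) (\<lambda>x i. X i x)) ?E) =
        complex_of_real (measure (distr N (\<Pi>\<^sub>M i\<in>UNIV. borel) (\<lambda>x i. Y i x)) ?E)"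
      unfolding prob[OF X] prob[OF Y] using J A by (intro mixed) auto
    then show "emeasure (distr M (\<Pi>\<^sub>M i\<in>UNIV. borel) (\<lambda>x i. X i x)) ?E =
        emeasure (distr N (\<Pi>\<^sub>M i\<in>UNIV. borel) (\<lambda>x i. Y i x)) ?E"
      by (simp add: finite_measure.emeasure_eq_measure prob_space.finite_measure
          M.prob_space_distr N.prob_space_distr measurable_abs_UNIV)
  qed (simp_all add: prob_space.finite_measure M.prob_space_distr measurable_abs_UNIV)
qed

section \<open>Reflection of Gaussian variables and processes\<close>

lemma gaussian_rv_integrable:
  assumes "prob_space M" "gaussian_rv M Y"
  shows "integrable M Y"
proof -
  interpret prob_space M by fact
  have [measurable]: "Y \<in> borel_measurable M" using assms by (simp add: gaussian_rv_def)
  consider (normal) \<mu> \<sigma> where "0 < \<sigma>" "distributed M lborel Y (normal_density \<mu> \<sigma>)"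
    | (const) \<mu> where "AE x in M. Y x = \<mu>"
    using assms by (auto simp: gaussian_rv_def)
  then show ?thesis
  proof cases
    case normal
    then show ?thesis
      using integrable_normal_moment_nz_1[of \<sigma> \<mu>]
        distributed_integrable[OF normal(2), of "\<lambda>x. x"] by auto
  next
    case const
    then show ?thesis
      by (subst integrable_cong_AE[of _ _ "\<lambda>_. \<mu>"]) auto
  qed
qed

text \<open>A normal law is symmetric about its mean, and an almost surely constant variable is
  almost surely fixed by the reflection.\<close>

lemma gaussian_rv_reflect:
  assumes "prob_space M" "gaussian_rv M Y"
  shows "distr M borel (\<lambda>x. 2 * integral\<^sup>L M Y - Y x) = distr M borel Y"
proof -
  interpret prob_space M by fact
  have [measurable]: "Y \<in> borel_measurable M" using assms by (simp add: gaussian_rv_def)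
  consider (normal) \<mu> \<sigma> where "0 < \<sigma>" "distributed M lborel Y (normal_density \<mu> \<sigma>)"
    | (const) \<mu> where "AE x in M. Y x = \<mu>"
    using assms by (auto simp: gaussian_rv_def)
  then show ?thesis
  proof cases
    case normal
    have "integral\<^sup>L M Y = \<mu>"
      by (rule normal_distributed_expectation[OF normal])
    \<comment> \<open>The affine map with slope -1 and shift \<open>2 * \<mu>\<close> preserves both
      the mean and the standard deviation.\<close>
    then have "distributed M lborel (\<lambda>x. 2 * integral\<^sup>L M Y - Y x) (normal_density \<mu> \<sigma>)"
      using normal_density_affine[OF normal(2,1), of "-1" "2 * \<mu>"] by simp
    then have "distr M lborel (\<lambda>x. 2 * integral\<^sup>L M Y - Y x) = distr M lborel Y"
      using normal(2) by (simp add: distributed_distr_eq_density)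
    then show ?thesis by (simp cong: distr_cong)
  next
    case const
    then have "integral\<^sup>L M Y = \<mu>"
      by (subst integral_cong_AE[of _ _ "\<lambda>_. \<mu>"]) (auto simp: prob_space)
    with const show ?thesis
      by (intro distr_cong_AE) (auto elim: eventually_mono)
  qed
qed

text \<open>By linearity of expectation, a finite combination of the reflected variables is the
  reflection of the same combination \<open>?S\<close>. As \<open>?S\<close> is Gaussian, the
  reflection preserves its law and so its characteristic function, which suffices by
  \<open>distr_PiM_eq_of_cis\<close>.\<close>

lemma gaussian_process_reflect:
  fixes X :: "nat \<Rightarrow> 'w \<Rightarrow> real"
  assumes M: "prob_space M" and X: "gaussian_process M X"
  shows "distr M (\<Pi>\<^sub>M n\<in>UNIV. borel) (\<lambda>\<omega> n. 2 * integral\<^sup>L M (X n) - X n \<omega>) =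
    distr M (\<Pi>\<^sub>M n\<in>UNIV. borel) (\<lambda>\<omega> n. X n \<omega>)"
proof (rule distr_PiM_eq_of_cis[OF M M])
  have cis: "cis \<in> borel_measurable borel"
    by (intro borel_measurable_continuous_onI continuous_intros)
  have rv: "gaussian_rv M (\<lambda>\<omega>. \<Sum>n\<in>F. c n * X n \<omega>)" if "finite F" for F c
    using X that by (simp add: gaussian_process_def)
  have "gaussian_rv M (X n)" for n
    using rv[of "{n}" "\<lambda>_. 1"] by simp
  then have int: "integrable M (X n)" for n
    using gaussian_rv_integrable M by blast
  then show X_meas [measurable]: "X n \<in> borel_measurable M" for n by auto
  then show "(\<lambda>\<omega>. 2 * integral\<^sup>L M (X n) - X n \<omega>) \<in> borel_measurable M" for n by auto
  fix F :: "nat set" and c :: "nat \<Rightarrow> real" assume F: "finite F"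
  let ?S = "\<lambda>\<omega>. \<Sum>n\<in>F. c n * X n \<omega>"
  have "(\<integral>\<omega>. cis (\<Sum>n\<in>F. c n * (2 * integral\<^sup>L M (X n) - X n \<omega>)) \<partial>M) =
      (\<integral>\<omega>. cis (2 * integral\<^sup>L M ?S - ?S \<omega>) \<partial>M)"
    using int by (simp add: right_diff_distrib sum_subtractf sum_distrib_left mult_ac)
  also have "\<dots> = (\<integral>s. cis s \<partial>distr M borel (\<lambda>\<omega>. 2 * integral\<^sup>L M ?S - ?S \<omega>))"
    by (rule integral_distr[symmetric]) (use cis in auto)
  also have "\<dots> = (\<integral>\<omega>. cis (?S \<omega>) \<partial>M)"
    unfolding gaussian_rv_reflect[OF M rv[OF F]] by (rule integral_distr) (use cis in auto)
  finally show "(\<integral>\<omega>. cis (\<Sum>n\<in>F. c n * (2 * integral\<^sup>L M (X n) - X n \<omega>)) \<partial>M) =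
      (\<integral>\<omega>. cis (?S \<omega>) \<partial>M)" .
qed

section \<open>Transfer between the process, its centered version and its mean\<close>

theorem lemma3:
  fixes M :: "'w measure" and X :: "nat \<Rightarrow> 'w \<Rightarrow> real" and p :: real
  assumes "prob_space M"
    and "0 < p"
    and "gaussian_process M X"
  shows "Lp_property M p (\<lambda>n \<omega>. complex_of_real (X n \<omega>)) \<longleftrightarrow>
      Lp_property M p (\<lambda>n \<omega>. complex_of_real (X n \<omega> - prob_space.expectation M (X n))) \<and>
      coefficient_multiplier_H2 p (\<lambda>n. complex_of_real (prob_space.expectation M (X n)))"
proof -
  interpret prob_space M by fact
  define m where "m n = integral\<^sup>L M (X n)" for n
  have rv: "gaussian_rv M (X n)" for n
    using assms(3)[unfolded gaussian_process_def, rule_format, of "{n}" "\<lambda>_. 1"] by simp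
  then have [measurable]: "X n \<in> borel_measurable M" for n by (simp add: gaussian_rv_def)
  show ?thesis
    unfolding m_def[symmetric]
  proof (intro iffI conjI)
    assume L: "Lp_property M p (\<lambda>n \<omega>. complex_of_real (X n \<omega>))"
    have mult: "series_in_hardy p (\<lambda>n. a n * m n)" if a: "series_in_hardy 2 a" for a
    proof -
      let ?S = "\<lambda>x :: nat \<Rightarrow> real. series_in_hardy p (\<lambda>n. a n * complex_of_real (x n))"
      let ?P = "\<Pi>\<^sub>M n\<in>(UNIV::nat set). (borel :: real measure)"
      \<comment> \<open>Measurability on sequence space lets the almost sure statement pass from
        \<open>M\<close> to the law of the process and back along the reflected process.\<close>
      have S: "{x\<in>space ?P. ?S x} \<in> sets ?P"
        by (intro sets_Collect_series_in_hardy assms(2)) measurable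
      have 1: "AE \<omega> in M. ?S (\<lambda>n. X n \<omega>)"
        using L a by (simp add: Lp_property_def)
      then have "AE x in distr M ?P (\<lambda>\<omega> n. X n \<omega>). ?S x"
        by (subst AE_distr_iff[OF _ S]) (auto intro!: measurable_abs_UNIV)
      then have "AE x in distr M ?P (\<lambda>\<omega> n. 2 * m n - X n \<omega>). ?S x"
        unfolding m_def gaussian_process_reflect[OF assms(1,3)] .
      then have "AE \<omega> in M. ?S (\<lambda>n. 2 * m n - X n \<omega>)"
        by (subst (asm) AE_distr_iff[OF _ S]) (auto intro!: measurable_abs_UNIV)
      with 1 have "AE \<omega> in M. series_in_hardy p (\<lambda>n. a n * m n)"
      proof eventually_elim
        case (elim \<omega>)
        show ?case
          \<comment> \<open>The random terms cancel in
            \<open>X n \<omega> + (2 * m n - X n \<omega>)\<close>, and the factor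
            \<open>1 / 2\<close> leaves \<open>m n\<close>.\<close>
          using series_in_hardy_cmult[OF series_in_hardy_add[OF elim assms(2)], of "1 / 2"]
          by (simp add: algebra_simps)
      qed
      \<comment> \<open>The statement no longer depends on the sample point, and on a probability
        space a constant statement that holds almost surely is true.\<close>
      then show ?thesis by simp
    qed
    then show "coefficient_multiplier_H2 p (\<lambda>n. complex_of_real (m n))"
      by (simp add: coefficient_multiplier_H2_def)
    show "Lp_property M p (\<lambda>n \<omega>. complex_of_real (X n \<omega> - m n))"
      unfolding Lp_property_def
    proof (intro allI impI)
      fix a assume a: "series_in_hardy 2 a"
      then have "AE \<omega> in M. series_in_hardy p (\<lambda>n. a n * complex_of_real (X n \<omega>))"
        using L by (simp add: Lp_property_def)
      then show "AE \<omega> in M. series_in_hardy p (\<lambda>n. a n * complex_of_real (X n \<omega> - m n))"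
      proof eventually_elim
        case (elim \<omega>)
        show ?case
          using series_in_hardy_add[OF elim series_in_hardy_cmult[OF mult[OF a], of "-1"] assms(2)]
          by (simp add: algebra_simps)
      qed
    qed
  next
    assume R: "Lp_property M p (\<lambda>n \<omega>. complex_of_real (X n \<omega> - m n)) \<and>
      coefficient_multiplier_H2 p (\<lambda>n. complex_of_real (m n))"
    show "Lp_property M p (\<lambda>n \<omega>. complex_of_real (X n \<omega>))"
      unfolding Lp_property_def
    proof (intro allI impI)
      fix a assume a: "series_in_hardy 2 a"
      then have m: "series_in_hardy p (\<lambda>n. a n * m n)"
        and "AE \<omega> in M. series_in_hardy p (\<lambda>n. a n * complex_of_real (X n \<omega> - m n))"
        using R by (auto simp: Lp_property_def coefficient_multiplier_H2_def)
      from this(2) show "AE \<omega> in M. series_in_hardy p (\<lambda>n. a n * complex_of_real (X n \<omega>))"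
      proof eventually_elim
        case (elim \<omega>)
        show ?case
          using series_in_hardy_add[OF elim m assms(2)] by (simp add: algebra_simps)
      qed
    qed
  qed
qed

end
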